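(* Let $H$ be a non-elementary (word-)hyperbolic group with a fixed finite generating set. Let $A$ and $B$ be quasiconvex subgroups of $H$ of infinite index. Then there exist a constant $\lambda>0$ and an $r_0$ such that for all integers $r\ge r_0$, $$gr(H,A,B)(r)\ \ge\ \lambda\, f_H(r).$$
   Context: A hyperbolic group is non-elementary if it is not virtually cyclic (in particular it is infinite). For $h\in H$, $|h|$ denotes the word length with respect to the fixed finite generating set. The growth function of $H$ is $f_H(r)=|\{h\in H : |h|\le r\}|$. For subgroups $A,B$ of $H$, the growth function of double cosets is $$gr(H,A,B)(r)=\bigl|\{AhB : h\in H,\ |h|\le r\}\bigr|,$$ the number of distinct double cosets $AhB$ having a representative of length at most $r$. A subgroup $A$ of $H$ is quasiconvex if there is $K\ge 0$ such that every geodesic in the Cayley graph of $H$ (with respect to the fixed finite generating set) with both endpoints in $A$ lies in the $K$-neighborhood of $A$. *)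

theory Defs
  imports Complex_Main "HOL-Algebra.Elementary_Groups"
begin

definition finite_generating_set :: "('a, 'm) monoid_scheme \<Rightarrow> 'a set \<Rightarrow> bool" where
  "finite_generating_set G S \<longleftrightarrow> finite S \<and> S \<subseteq> carrier G \<and> generate G S = carrier G"

definition word_value :: "('a, 'm) monoid_scheme \<Rightarrow> 'a list \<Rightarrow> 'a" where
  "word_value G ws = foldr (mult G) ws (one G)"

text \<open>Words are over \<open>S\<close> and the inverses of its elements. The \<open>LEAST\<close> below is meaningful
  only for elements of the subgroup generated by \<open>S\<close>.\<close>

definition word_length :: "('a, 'm) monoid_scheme \<Rightarrow> 'a set \<Rightarrow> 'a \<Rightarrow> nat" where
  "word_length G S g =
    (LEAST n. \<exists>ws. length ws = n \<and> set ws \<subseteq> S \<union> (set_inv\<^bsub>G\<^esub> S) \<and> word_value G ws = g)"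

definition word_dist :: "('a, 'm) monoid_scheme \<Rightarrow> 'a set \<Rightarrow> 'a \<Rightarrow> 'a \<Rightarrow> nat" where
  "word_dist G S x y = word_length G S (inv\<^bsub>G\<^esub> x \<otimes>\<^bsub>G\<^esub> y)"

definition cayley_adj :: "('a, 'm) monoid_scheme \<Rightarrow> 'a set \<Rightarrow> 'a \<Rightarrow> 'a \<Rightarrow> bool" where
  "cayley_adj G S x y \<longleftrightarrow>
    x \<in> carrier G \<and> y \<in> carrier G \<and> (\<exists>s \<in> S \<union> (set_inv\<^bsub>G\<^esub> S). y = x \<otimes>\<^bsub>G\<^esub> s)"

text \<open>A geodesic between two vertices of the Cayley graph is an edge path whose number of edges
  is the distance of its endpoints; it is represented by its list of vertices.\<close>

definition geodesic :: "('a, 'm) monoid_scheme \<Rightarrow> 'a set \<Rightarrow> 'a \<Rightarrow> 'a \<Rightarrow> 'a list \<Rightarrow> bool" where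
  "geodesic G S x y p \<longleftrightarrow>
    p \<noteq> [] \<and> hd p = x \<and> last p = y \<and> set p \<subseteq> carrier G \<and>
    (\<forall>i. Suc i < length p \<longrightarrow> cayley_adj G S (p ! i) (p ! Suc i)) \<and>
    length p = Suc (word_dist G S x y)"

text \<open>Geodesic triangles in the Cayley graph are \<open>\<delta>\<close>-slim. Triangles have their corners at
  vertices of the graph, and slimness is tested at the vertices of the sides; compared with the
  geometric realization this only changes the constant \<open>\<delta>\<close>. It suffices to state the condition
  for one side, since the three sides can be permuted cyclically.\<close>

definition hyperbolic :: "('a, 'm) monoid_scheme \<Rightarrow> 'a set \<Rightarrow> bool" where
  "hyperbolic G S \<longleftrightarrow> (\<exists>\<delta>::real. \<delta> \<ge> 0 \<and>
    (\<forall>x y z p q r. geodesic G S x y p \<and> geodesic G S y z q \<and> geodesic G S z x r \<longrightarrow>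
      (\<forall>v \<in> set p. \<exists>w \<in> set q \<union> set r. real (word_dist G S v w) \<le> \<delta>)))"

definition finite_index :: "('a, 'm) monoid_scheme \<Rightarrow> 'a set \<Rightarrow> bool" where
  "finite_index G A \<longleftrightarrow> finite (rcosets\<^bsub>G\<^esub> A)"

definition virtually_cyclic :: "('a, 'm) monoid_scheme \<Rightarrow> bool" where
  "virtually_cyclic G \<longleftrightarrow>
    (\<exists>C. subgroup C G \<and> cyclic_group (G\<lparr>carrier := C\<rparr>) \<and> finite_index G C)"

definition quasiconvex :: "('a, 'm) monoid_scheme \<Rightarrow> 'a set \<Rightarrow> 'a set \<Rightarrow> bool" where
  "quasiconvex G S A \<longleftrightarrow> (\<exists>K::real. K \<ge> 0 \<and>
    (\<forall>x \<in> A. \<forall>y \<in> A. \<forall>p. geodesic G S x y p \<longrightarrow>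
      (\<forall>v \<in> set p. \<exists>a \<in> A. real (word_dist G S v a) \<le> K)))"

definition growth :: "('a, 'm) monoid_scheme \<Rightarrow> 'a set \<Rightarrow> nat \<Rightarrow> nat" where
  "growth G S r = card {h \<in> carrier G. word_length G S h \<le> r}"

definition double_coset :: "('a, 'm) monoid_scheme \<Rightarrow> 'a set \<Rightarrow> 'a \<Rightarrow> 'a set \<Rightarrow> 'a set" where
  "double_coset G A h B = (A #>\<^bsub>G\<^esub> h) <#>\<^bsub>G\<^esub> B"

definition double_coset_growth ::
    "('a, 'm) monoid_scheme \<Rightarrow> 'a set \<Rightarrow> 'a set \<Rightarrow> 'a set \<Rightarrow> nat \<Rightarrow> nat" where
  "double_coset_growth G S A B r =
    card {double_coset G A h B | h. h \<in> carrier G \<and> word_length G S h \<le> r}"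

end

theory Submission
  imports Defs
begin

text \<open>Call \<open>h\<close> reduced for a subgroup \<open>A\<close> if \<open>1\<close> is, up to a constant, a nearest point of \<open>A\<close> to \<open>h\<close>.
  By hyperbolicity a double coset \<open>A h B\<close> contains boundedly many long elements \<open>g\<close> such that \<open>g\<close>
  is reduced for \<open>A\<close> and \<open>inv g\<close> for \<open>B\<close>. On the other hand infinite index allows every \<open>h\<close> to be
  turned into such an element \<open>x h y\<close> with \<open>x, y\<close> of bounded length, so these elements are a
  positive proportion of each ball.\<close>

section \<open>Word length, balls and the word metric\<close>

locale marked_group = group G for G (structure) +
  fixes S :: "'a set"
  assumes finite_gen: "finite_generating_set G S"
begin

abbreviation letters :: "'a set" where "letters \<equiv> S \<union> (set_inv\<^bsub>G\<^esub> S)"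
abbreviation len :: "'a \<Rightarrow> nat" where "len \<equiv> word_length G S"
abbreviation d :: "'a \<Rightarrow> 'a \<Rightarrow> real" where "d x y \<equiv> real (word_dist G S x y)"
abbreviation ball :: "nat \<Rightarrow> 'a set" where "ball r \<equiv> {h \<in> carrier G. len h \<le> r}"

lemma mult_inv_cancel [simp]:
  assumes "x \<in> carrier G" "y \<in> carrier G"
  shows "x \<otimes> (inv x \<otimes> y) = y" "inv x \<otimes> (x \<otimes> y) = y"
  using assms by (simp_all flip: m_assoc)

lemma letters_carrier: "letters \<subseteq> carrier G"
  using finite_gen by (auto simp: finite_generating_set_def SET_INV_def)

lemma finite_letters: "finite letters"
  using finite_gen by (auto simp: finite_generating_set_def SET_INV_def)

lemma inv_letters: "s \<in> letters \<Longrightarrow> inv s \<in> letters"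
  using finite_gen by (fastforce simp: finite_generating_set_def SET_INV_def)

lemma word_value_Nil [simp]: "word_value G [] = \<one>"
  by (simp add: word_value_def)

lemma word_value_Cons [simp]: "word_value G (s # ws) = s \<otimes> word_value G ws"
  by (simp add: word_value_def)

lemma word_value_closed: "set ws \<subseteq> letters \<Longrightarrow> word_value G ws \<in> carrier G"
  using letters_carrier by (induction ws) auto

lemma word_value_append:
  "set us \<subseteq> letters \<Longrightarrow> set ws \<subseteq> letters \<Longrightarrow>
    word_value G (us @ ws) = word_value G us \<otimes> word_value G ws"
proof (induction us)
  case (Cons s us)
  then show ?case
    using letters_carrier word_value_closed by (auto simp: m_assoc subset_iff)
qed (simp add: word_value_closed)

lemma word_value_inv:
  "set ws \<subseteq> letters \<Longrightarrow> word_value G (rev (map (\<lambda>s. inv s) ws)) = inv (word_value G ws)"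
proof (induction ws)
  case (Cons s ws)
  have s: "s \<in> letters" "s \<in> carrier G" and ws: "set ws \<subseteq> letters"
    using Cons.prems letters_carrier by auto
  have "set (rev (map (\<lambda>s. inv s) ws)) \<subseteq> letters" "set [inv s] \<subseteq> letters"
    using s ws inv_letters by auto
  from word_value_append[OF this] show ?case
    using Cons.IH[OF ws] s word_value_closed[OF ws] by (simp add: inv_mult_group)
qed simp

lemma ex_word:
  assumes "g \<in> carrier G"
  shows "\<exists>ws. set ws \<subseteq> letters \<and> word_value G ws = g"
proof -
  have "g \<in> generate G S" using assms finite_gen by (simp add: finite_generating_set_def)
  then show ?thesis
  proof (induction rule: generate.induct)
    case one
    show ?case by (rule exI[of _ "[]"]) simp
  next
    case (incl h)
    then show ?case using letters_carrier by (intro exI[of _ "[h]"]) auto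
  next
    case (inv h)
    then have "inv h \<in> letters" by (auto simp: SET_INV_def)
    then show ?case using letters_carrier by (intro exI[of _ "[inv h]"]) auto
  next
    case (eng h1 h2)
    then obtain u w where "set u \<subseteq> letters" "word_value G u = h1"
      "set w \<subseteq> letters" "word_value G w = h2" by blast
    then show ?case using word_value_append by (intro exI[of _ "u @ w"]) auto
  qed
qed

lemma ex_shortest_word:
  assumes "g \<in> carrier G"
  obtains ws where "length ws = len g" "set ws \<subseteq> letters" "word_value G ws = g"
proof -
  have "\<exists>n ws. length ws = n \<and> set ws \<subseteq> letters \<and> word_value G ws = g"
    using ex_word[OF assms] by blast
  from LeastI_ex[OF this] show ?thesis using that unfolding word_length_def by blast
qed

lemma len_word_value_le: "set ws \<subseteq> letters \<Longrightarrow> len (word_value G ws) \<le> length ws"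
  unfolding word_length_def by (rule Least_le) blast

lemma len_one [simp]: "len \<one> = 0"
  using len_word_value_le[of "[]"] by simp

lemma len_inv_le: "g \<in> carrier G \<Longrightarrow> len (inv g) \<le> len g"
proof -
  assume "g \<in> carrier G"
  then obtain ws where ws: "length ws = len g" "set ws \<subseteq> letters" "word_value G ws = g"
    by (rule ex_shortest_word)
  have "set (rev (map (\<lambda>s. inv s) ws)) \<subseteq> letters" using ws(2) inv_letters by auto
  from len_word_value_le[OF this] show ?thesis using ws word_value_inv by simp
qed

lemma len_inv [simp]: "g \<in> carrier G \<Longrightarrow> len (inv g) = len g"
  using len_inv_le[of g] len_inv_le[of "inv g"] by simp

lemma len_mult_le: "g \<in> carrier G \<Longrightarrow> h \<in> carrier G \<Longrightarrow> len (g \<otimes> h) \<le> len g + len h"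
proof -
  assume "g \<in> carrier G" "h \<in> carrier G"
  obtain u where u: "length u = len g" "set u \<subseteq> letters" "word_value G u = g"
    by (rule ex_shortest_word[OF \<open>g \<in> carrier G\<close>])
  obtain w where w: "length w = len h" "set w \<subseteq> letters" "word_value G w = h"
    by (rule ex_shortest_word[OF \<open>h \<in> carrier G\<close>])
  show ?thesis using len_word_value_le[of "u @ w"] u w word_value_append by simp
qed

lemma finite_ball: "finite (ball r)"
proof (rule finite_subset)
  show "ball r \<subseteq> word_value G ` {ws. set ws \<subseteq> letters \<and> length ws \<le> r}"
  proof
    fix g assume g: "g \<in> ball r"
    then have "g \<in> carrier G" by simp
    then obtain ws where "length ws = len g" "set ws \<subseteq> letters" "word_value G ws = g"
      by (rule ex_shortest_word)
    then show "g \<in> word_value G ` {ws. set ws \<subseteq> letters \<and> length ws \<le> r}" using g by auto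
  qed
  show "finite (word_value G ` {ws. set ws \<subseteq> letters \<and> length ws \<le> r})"
    using finite_lists_length_le[OF finite_letters] by auto
qed

lemma card_ball_pos: "card (ball r) > 0"
  using finite_ball[of r] by (auto simp: card_gt_0_iff intro!: exI[of _ \<one>])

text \<open>A shortest word is cut after \<open>r\<close> letters. This makes the loss from a
  bounded change of radius a constant factor.\<close>

lemma card_ball_add_le: "card (ball (r + m)) \<le> card (ball r) * card (ball m)"
proof -
  have "ball (r + m) \<subseteq> (\<lambda>(g, h). g \<otimes> h) ` (ball r \<times> ball m)"
  proof
    fix g assume g: "g \<in> ball (r + m)"
    then have "g \<in> carrier G" by simp
    then obtain ws where ws: "length ws = len g" "set ws \<subseteq> letters" "word_value G ws = g"
      by (rule ex_shortest_word)
    have sub: "set (take r ws) \<subseteq> letters" "set (drop r ws) \<subseteq> letters"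
      using ws(2) set_take_subset[of r ws] set_drop_subset[of r ws] by blast+
    have "word_value G (take r ws) \<in> ball r" "word_value G (drop r ws) \<in> ball m"
      using len_word_value_le[OF sub(1)] len_word_value_le[OF sub(2)] word_value_closed sub ws g
      by auto
    moreover have "g = word_value G (take r ws) \<otimes> word_value G (drop r ws)"
      using word_value_append[OF sub] ws(3) by simp
    ultimately show "g \<in> (\<lambda>(g, h). g \<otimes> h) ` (ball r \<times> ball m)" by force
  qed
  then have "card (ball (r + m)) \<le> card (ball r \<times> ball m)"
    using finite_ball by (intro surj_card_le) auto
  then show ?thesis by (simp add: card_cartesian_product)
qed

lemma d_one [simp]: "x \<in> carrier G \<Longrightarrow> d \<one> x = len x"
  by (simp add: word_dist_def)

lemma d_self [simp]: "x \<in> carrier G \<Longrightarrow> d x x = 0"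
  by (simp add: word_dist_def)

lemma d_sym: "x \<in> carrier G \<Longrightarrow> y \<in> carrier G \<Longrightarrow> d x y = d y x"
  using len_inv[of "inv x \<otimes> y"] by (simp add: word_dist_def inv_mult_group)

lemma d_left [simp]:
  assumes "g \<in> carrier G" "x \<in> carrier G" "y \<in> carrier G"
  shows "d (g \<otimes> x) (g \<otimes> y) = d x y"
proof -
  have "inv (g \<otimes> x) \<otimes> (g \<otimes> y) = inv x \<otimes> y"
    using assms by (simp add: inv_mult_group m_assoc)
  then show ?thesis by (simp add: word_dist_def)
qed

lemma d_triangle:
  assumes "x \<in> carrier G" "y \<in> carrier G" "z \<in> carrier G"
  shows "d x z \<le> d x y + d y z"
proof -
  have "inv x \<otimes> z = (inv x \<otimes> y) \<otimes> (inv y \<otimes> z)"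
    using assms by (simp add: m_assoc)
  then show ?thesis using len_mult_le[of "inv x \<otimes> y" "inv y \<otimes> z"] assms
    by (simp add: word_dist_def)
qed

lemma d_right:
  assumes "x \<in> carrier G" "y \<in> carrier G"
  shows "d x (x \<otimes> y) = len y"
  using d_left[of x \<one> y] assms by simp

section \<open>Geodesics in the Cayley graph\<close>

lemma ex_geodesic:
  assumes x: "x \<in> carrier G" and y: "y \<in> carrier G"
  obtains p where "geodesic G S x y p"
proof -
  have "inv x \<otimes> y \<in> carrier G" using x y by simp
  then obtain ws where ws: "length ws = len (inv x \<otimes> y)" "set ws \<subseteq> letters"
    "word_value G ws = inv x \<otimes> y" by (rule ex_shortest_word)
  \<comment> \<open>The vertices are the translates by \<open>x\<close> of all prefixes of a
    shortest word, including the empty and the full one.\<close>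
  define p where "p = map (\<lambda>i. x \<otimes> word_value G (take i ws)) [0..<Suc (length ws)]"
  have lp: "length p = Suc (length ws)" by (simp add: p_def)
  have nth: "p ! i = x \<otimes> word_value G (take i ws)" if "i \<le> length ws" for i
    using that unfolding p_def by (subst nth_map) (auto simp del: upt_Suc)
  have sub: "set (take i ws) \<subseteq> letters" for i
    using ws(2) set_take_subset[of i ws] by blast
  have "p \<noteq> []" using lp by auto
  moreover have "hd p = x"
    using nth[of 0] lp \<open>p \<noteq> []\<close> x by (simp add: hd_conv_nth)
  moreover have "last p = y"
    using nth[of "length ws"] lp \<open>p \<noteq> []\<close> x y ws(3) by (simp add: last_conv_nth)
  moreover have car: "set p \<subseteq> carrier G"
    using word_value_closed[OF sub] word_value_closed[OF ws(2)] x by (auto simp: p_def)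
  moreover have "cayley_adj G S (p ! i) (p ! Suc i)" if "Suc i < length p" for i
  proof -
    have i: "i < length ws" using that lp by simp
    have s: "ws ! i \<in> letters" using i ws(2) nth_mem by blast
    have "word_value G (take (Suc i) ws) = word_value G (take i ws) \<otimes> (ws ! i)"
      using s letters_carrier word_value_append[OF sub, of "[ws ! i]" i] i
      by (auto simp: take_Suc_conv_app_nth)
    then have "p ! Suc i = p ! i \<otimes> ws ! i"
      using nth[of i] nth[of "Suc i"] i x word_value_closed[OF sub] s letters_carrier
      by (auto simp: m_assoc)
    moreover have "p ! i \<in> carrier G" "p ! Suc i \<in> carrier G"
      using car that by auto
    ultimately show ?thesis unfolding cayley_adj_def using s by blast
  qed
  ultimately have "geodesic G S x y p"
    using ws(1) lp unfolding geodesic_def word_dist_def by simp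
  then show ?thesis by (rule that)
qed

lemma geodesic_adj:
  assumes "geodesic G S x y p" "Suc i < length p"
  shows "d (p ! i) (p ! Suc i) \<le> 1"
proof -
  obtain s where s: "s \<in> letters" "p ! i \<in> carrier G" "p ! Suc i = p ! i \<otimes> s"
    using assms unfolding geodesic_def cayley_adj_def by blast
  have "len s \<le> 1"
    using len_word_value_le[of "[s]"] s(1) letters_carrier by auto
  then show ?thesis using s letters_carrier d_right by auto
qed

text \<open>Counting edges bounds both distances from above by \<open>i\<close> and
  \<open>d x y - i\<close>; these bounds add up to \<open>d x y\<close>, so the triangle inequality
  forces equality.\<close>

lemma geodesic_nth:
  assumes p: "geodesic G S x y p" and i: "real i \<le> d x y"
  shows "p ! i \<in> set p" "p ! i \<in> carrier G" "d x (p ! i) = i" "d (p ! i) y = d x y - i"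
proof -
  have lp: "length p = Suc (word_dist G S x y)" and ne: "p \<noteq> []" and car: "set p \<subseteq> carrier G"
    and hd: "p ! 0 = x" and last: "p ! (word_dist G S x y) = y"
    using p hd_conv_nth[of p] last_conv_nth[of p] unfolding geodesic_def by simp_all
  have c: "p ! j \<in> carrier G" if "j < length p" for j using that car by auto
  have xy: "x \<in> carrier G" "y \<in> carrier G" using c[of 0] c[of "word_dist G S x y"] lp hd last by auto
  have steps: "d (p ! j) (p ! (j + k)) \<le> k" if "j + k < length p" for j k
    using that
  proof (induction k)
    case 0
    then show ?case using c by simp
  next
    case (Suc k)
    then have "d (p ! j) (p ! (j + k)) \<le> k" by simp
    moreover have "d (p ! (j + k)) (p ! Suc (j + k)) \<le> 1"
      using geodesic_adj[OF p] Suc.prems by simp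
    ultimately show ?case
      using d_triangle[of "p ! j" "p ! (j + k)" "p ! Suc (j + k)"] c Suc.prems by simp
  qed
  have il: "i < length p" using i lp by simp
  then show m: "p ! i \<in> set p" "p ! i \<in> carrier G" using car by auto
  have "d x (p ! i) \<le> i" using steps[of 0 i] il hd by simp
  moreover have "d (p ! i) y \<le> d x y - i"
    using steps[of i "word_dist G S x y - i"] i lp last by (simp add: of_nat_diff)
  moreover have "d x y \<le> d x (p ! i) + d (p ! i) y" using d_triangle xy m by blast
  ultimately show "d x (p ! i) = i" "d (p ! i) y = d x y - i" by linarith+
qed

lemma geodesic_mem:
  assumes p: "geodesic G S x y p" and v: "v \<in> set p"
  shows "v \<in> carrier G" "d x v + d v y = d x y"
proof -
  obtain i where i: "i < length p" "v = p ! i" using v by (auto simp: in_set_conv_nth)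
  then have "real i \<le> d x y" using p by (simp add: geodesic_def)
  from geodesic_nth[OF p this] i show "v \<in> carrier G" "d x v + d v y = d x y" by simp_all
qed

lemma geodesic_ends:
  assumes "geodesic G S x y p"
  shows "x \<in> set p" "y \<in> set p"
  using assms by (auto simp: geodesic_def)

section \<open>Gromov products, with the base point as first argument\<close>

definition gromov :: "'a \<Rightarrow> 'a \<Rightarrow> 'a \<Rightarrow> real" where
  "gromov w x y = (d w x + d w y - d x y) / 2"

lemma gromov_sym: "x \<in> carrier G \<Longrightarrow> y \<in> carrier G \<Longrightarrow> gromov w x y = gromov w y x"
  by (simp add: gromov_def d_sym)

lemma gromov_left:
  "\<lbrakk>g \<in> carrier G; w \<in> carrier G; x \<in> carrier G; y \<in> carrier G\<rbrakk> \<Longrightarrow>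
    gromov (g \<otimes> w) (g \<otimes> x) (g \<otimes> y) = gromov w x y"
  by (simp add: gromov_def)

lemma gromov_le_geodesic:
  assumes p: "geodesic G S x y p" and v: "v \<in> set p"
    and c: "x \<in> carrier G" "y \<in> carrier G" "w \<in> carrier G"
  shows "gromov w x y \<le> d w v"
  using geodesic_mem[OF p v] d_triangle[of w v x] d_triangle[of w v y] d_sym[of x v] c
  by (simp add: gromov_def)

lemma double_coset_iff:
  assumes "A \<subseteq> carrier G" "B \<subseteq> carrier G" "h \<in> carrier G"
  shows "g \<in> double_coset G A h B \<longleftrightarrow> (\<exists>a\<in>A. \<exists>b\<in>B. g = a \<otimes> h \<otimes> b)"
  by (auto simp: double_coset_def r_coset_def set_mult_def)

lemma mem_double_coset:
  assumes "subgroup A G" "subgroup B G" "h \<in> carrier G"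
  shows "h \<in> double_coset G A h B"
  using assms subgroup.one_closed[OF assms(1)] subgroup.one_closed[OF assms(2)]
  by (subst double_coset_iff) (auto dest: subgroup.subset intro!: bexI[of _ \<one>])

end

section \<open>Slim triangles and the four-point inequality\<close>

locale hyperbolic_group = marked_group +
  fixes \<delta>\<^sub>0 :: real
  assumes \<delta>\<^sub>0_nonneg: "\<delta>\<^sub>0 \<ge> 0"
    and slim: "\<lbrakk>geodesic G S x y p; geodesic G S y z q; geodesic G S z x r; v \<in> set p\<rbrakk>
      \<Longrightarrow> \<exists>w \<in> set q \<union> set r. d v w \<le> \<delta>\<^sub>0"
begin

text \<open>Converse of \<open>gromov_le_geodesic\<close> up to a constant. Walking along
  \<open>p\<close> from \<open>x\<close> to \<open>y\<close>, the first vertex close to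
  \<open>[y, w]\<close> is also close to \<open>[w, x]\<close>, because its predecessor is; a vertex
  close to both sides realises the product.\<close>

lemma geodesic_near_gromov:
  assumes p: "geodesic G S x y p" and c: "x \<in> carrier G" "y \<in> carrier G" "w \<in> carrier G"
  shows "\<exists>v\<in>set p. d w v \<le> gromov w x y + 2 * \<delta>\<^sub>0 + 1"
proof -
  obtain q where q: "geodesic G S y w q" using ex_geodesic c by blast
  obtain r where r: "geodesic G S w x r" using ex_geodesic c by blast
  define n where "n = word_dist G S x y"
  have lp: "length p = Suc n" and hd: "p ! 0 = x" and last: "p ! n = y"
    using p hd_conv_nth[of p] last_conv_nth[of p] unfolding geodesic_def n_def by simp_all
  define near where "near X v \<longleftrightarrow> (\<exists>u\<in>X. d v u \<le> \<delta>\<^sub>0)" for X v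
  have cover: "near (set r) (p ! i) \<or> near (set q) (p ! i)" if "i \<le> n" for i
    using slim[OF p q r, of "p ! i"] that lp unfolding near_def by force
  \<comment> \<open>The end \<open>y\<close> lies on \<open>q\<close> itself, so the
    \<open>LEAST\<close> below has a witness.\<close>
  have nq: "near (set q) (p ! n)"
    using geodesic_ends[OF q] last c \<delta>\<^sub>0_nonneg unfolding near_def by force
  define k where "k = (LEAST i. near (set q) (p ! i))"
  have kq: "near (set q) (p ! k)" unfolding k_def by (rule LeastI) (rule nq)
  have kn: "k \<le> n" unfolding k_def by (rule Least_le) (rule nq)
  have v: "p ! k \<in> set p" "p ! k \<in> carrier G" "d x (p ! k) = k" "d (p ! k) y = d x y - k"
    using geodesic_nth[OF p] kn by (auto simp: n_def)
  obtain t where t: "t \<in> set q" "d (p ! k) t \<le> \<delta>\<^sub>0" using kq unfolding near_def by blast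
  have tr: "\<exists>u\<in>set r. d (p ! k) u \<le> \<delta>\<^sub>0 + 1"
  proof (cases k)
    case 0
    then show ?thesis using geodesic_ends[OF r] hd c \<delta>\<^sub>0_nonneg by force
  next
    case (Suc j)
    have "j < (LEAST i. near (set q) (p ! i))" using Suc unfolding k_def by linarith
    then have "\<not> near (set q) (p ! j)" by (rule not_less_Least)
    then obtain u where u: "u \<in> set r" "d (p ! j) u \<le> \<delta>\<^sub>0"
      using cover[of j] kn Suc unfolding near_def by auto
    have pj: "p ! j \<in> carrier G" using geodesic_nth(2)[OF p, of j] kn Suc by (simp add: n_def)
    have "d (p ! k) (p ! j) \<le> 1"
      using geodesic_adj[OF p, of j] Suc kn lp d_sym[OF pj v(2)] by simp
    then have "d (p ! k) u \<le> \<delta>\<^sub>0 + 1"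
      using d_triangle[OF v(2) pj geodesic_mem(1)[OF r u(1)]] u(2) by linarith
    then show ?thesis using u(1) by blast
  qed
  then obtain u where u: "u \<in> set r" "d (p ! k) u \<le> \<delta>\<^sub>0 + 1" by blast
  note uc = geodesic_mem[OF r u(1)] and tc = geodesic_mem[OF q t(1)]
  \<comment> \<open>Since \<open>u\<close> and \<open>t\<close> lie on the sides, adding these two
    inequalities and the next two gives \<open>d w x + d w y\<close> on the right up to
    \<open>4 * \<delta>\<^sub>0 + 2\<close>, and \<open>2 * d w (p ! k) + d x y\<close> on the
    left.\<close>
  have "d w (p ! k) \<le> d w u + d (p ! k) u" "d x (p ! k) \<le> d u x + d (p ! k) u"
    using d_triangle[OF c(3) uc(1) v(2)] d_triangle[OF c(1) uc(1) v(2)]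
      d_sym[OF uc(1) v(2)] d_sym[OF uc(1) c(1)] by linarith+
  moreover have "d w (p ! k) \<le> d t w + d (p ! k) t" "d (p ! k) y \<le> d y t + d (p ! k) t"
    using d_triangle[OF c(3) tc(1) v(2)] d_triangle[OF v(2) tc(1) c(2)]
      d_sym[OF tc(1) v(2)] d_sym[OF tc(1) c(2)] d_sym[OF tc(1) c(3)] by linarith+
  ultimately have "d w (p ! k) \<le> gromov w x y + 2 * \<delta>\<^sub>0 + 1"
    using u(2) t(2) uc(2) tc(2) v(3,4) d_sym[OF c(2) c(3)]
    unfolding gromov_def by (simp add: field_simps)
  then show ?thesis using v(1) by blast
qed

text \<open>The sum of the error \<open>2 * \<delta>\<^sub>0 + 1\<close> of
  \<open>geodesic_near_gromov\<close> and one use of slimness.\<close>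

definition \<delta> :: real where "\<delta> = 3 * \<delta>\<^sub>0 + 1"

text \<open>A point of \<open>[x, z]\<close> nearly realising \<open>d w [x, z]\<close>, which is the Gromov product up to a
  constant, is \<open>\<delta>\<^sub>0\<close>-close to \<open>[x, y]\<close> or \<open>[y, z]\<close>.\<close>

lemma four_point:
  assumes c: "x \<in> carrier G" "y \<in> carrier G" "z \<in> carrier G" "w \<in> carrier G"
  shows "min (gromov w x y) (gromov w y z) - \<delta> \<le> gromov w x z"
proof -
  obtain p where p: "geodesic G S x z p" using ex_geodesic c by blast
  obtain q where q: "geodesic G S z y q" using ex_geodesic c by blast
  obtain r where r: "geodesic G S y x r" using ex_geodesic c by blast
  obtain v where v: "v \<in> set p" "d w v \<le> gromov w x z + 2 * \<delta>\<^sub>0 + 1"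
    using geodesic_near_gromov[OF p c(1,3,4)] by blast
  obtain u where u: "u \<in> set q \<union> set r" "d v u \<le> \<delta>\<^sub>0"
    using slim[OF p q r v(1)] by blast
  have uc: "u \<in> carrier G" using u(1) geodesic_mem(1)[OF q] geodesic_mem(1)[OF r] by blast
  have "min (gromov w x y) (gromov w y z) \<le> d w u"
    using u(1) gromov_le_geodesic[OF q _ c(3,2,4), of u] gromov_le_geodesic[OF r _ c(2,1,4), of u]
      gromov_sym[OF c(1,2), of w] gromov_sym[OF c(2,3), of w] by auto
  then show ?thesis
    using d_triangle[OF c(4) geodesic_mem(1)[OF p v(1)] uc] v(2) u(2) unfolding \<delta>_def by linarith
qed

section \<open>Elements reduced for a quasiconvex subgroup\<close>

definition reduced :: "'a set \<Rightarrow> real \<Rightarrow> 'a \<Rightarrow> bool" where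
  "reduced A C h \<longleftrightarrow> h \<in> carrier G \<and> (\<forall>a\<in>A. real (len h) \<le> d a h + C)"

definition quasiconvex_const :: "'a set \<Rightarrow> real \<Rightarrow> bool" where
  "quasiconvex_const A K \<longleftrightarrow> K \<ge> 0 \<and> (\<forall>x \<in> A. \<forall>y \<in> A. \<forall>p. geodesic G S x y p \<longrightarrow>
      (\<forall>v \<in> set p. \<exists>a \<in> A. d v a \<le> K))"

text \<open>If the product were large, a vertex far along \<open>[1, a]\<close> would be much closer
  to \<open>h\<close> than \<open>1\<close> is. Quasiconvexity moves this vertex into
  \<open>A\<close> at cost \<open>K\<close>, against reducedness.\<close>

lemma reduced_gromov_le:
  assumes A: "subgroup A G" and K: "quasiconvex_const A K"
    and h: "reduced A C h" and a: "a \<in> A"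
  shows "gromov \<one> a h \<le> C + 2 * \<delta> + K + 1"
proof -
  have ac: "a \<in> carrier G" and hc: "h \<in> carrier G"
    using A a h subgroup.mem_carrier by (auto simp: reduced_def)
  obtain p where p: "geodesic G S \<one> a p" using ex_geodesic ac by blast
  have "d a h \<le> d \<one> a + d \<one> h" "d \<one> h \<le> d \<one> a + d a h" "d \<one> a \<le> d \<one> h + d a h"
    using d_triangle[of \<one> a h] d_triangle[of \<one> h a] d_triangle[of a \<one> h] d_sym[of a h] d_sym[of a \<one>] ac hc by simp_all
  then have g: "0 \<le> gromov \<one> a h" "gromov \<one> a h \<le> d \<one> a" by (simp_all add: gromov_def)
  \<comment> \<open>Vertices have integer positions; rounding down accounts for the
    \<open>+ 1\<close> in the bound.\<close>
  define t where "t = nat \<lfloor>gromov \<one> a h\<rfloor>"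
  have t: "real t \<le> gromov \<one> a h" "gromov \<one> a h \<le> t + 1" using g unfolding t_def by linarith+
  then have "real t \<le> d \<one> a" using g by linarith
  note q = geodesic_nth[OF p this]
  have "gromov \<one> (p ! t) a = t" using q(3,4) by (simp add: gromov_def)
  then have "t - \<delta> \<le> gromov \<one> (p ! t) h"
    using four_point[OF q(2) ac hc one_closed] t(1) by simp
  then have 1: "d (p ! t) h \<le> real (len h) - t + 2 * \<delta>"
    using q(3) d_one[OF hc] unfolding gromov_def by (simp add: field_simps)
  obtain b where b: "b \<in> A" "d (p ! t) b \<le> K"
    using K p q(1) a subgroup.one_closed[OF A] unfolding quasiconvex_const_def by blast
  have bc: "b \<in> carrier G" by (rule subgroup.mem_carrier[OF A b(1)])
  have "len h \<le> d b h + C" using h b(1) unfolding reduced_def by blast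
  then show ?thesis
    using d_triangle[OF bc q(2) hc] d_sym[OF bc q(2)] b(2) 1 t(2) by linarith
qed

text \<open>The path \<open>1, a, ah, ahb\<close> has small Gromov products at its interior vertices and a long
  middle segment, so \<open>a\<close> lies near a geodesic from \<open>1\<close> to \<open>ahb\<close>.\<close>

lemma double_coset_rigid:
  assumes c: "a \<in> carrier G" "h \<in> carrier G" "b \<in> carrier G"
    and 1: "gromov \<one> (inv a) h \<le> D" and 2: "gromov \<one> b (inv h) \<le> D"
    and 3: "gromov \<one> a (a \<otimes> h \<otimes> b) \<le> D"
    and long: "len h > 2 * D + \<delta>"
  shows "len a \<le> 2 * D + \<delta>"
proof -
  define g where "g = a \<otimes> h \<otimes> b"
  have c': "a \<otimes> h \<in> carrier G" "g \<in> carrier G" using c by (simp_all add: g_def)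
  have g1: "gromov a \<one> (a \<otimes> h) \<le> D"
    using gromov_left[of a \<one> "inv a" h] c 1 by simp
  have "gromov (a \<otimes> h) g a = gromov ((a \<otimes> h) \<otimes> \<one>) ((a \<otimes> h) \<otimes> b) ((a \<otimes> h) \<otimes> inv h)"
    using c by (simp add: g_def m_assoc)
  then have g2: "gromov (a \<otimes> h) g a \<le> D"
    using gromov_left[of "a \<otimes> h" \<one> b "inv h"] c 2 by simp
  \<comment> \<open>The products at the two ends of a segment add up to its length; the same
    identity is used below for the segment from \<open>1\<close> to \<open>a\<close>.\<close>
  have "gromov a g (a \<otimes> h) = d a (a \<otimes> h) - gromov (a \<otimes> h) g a"
    using d_sym[OF c(1) c'(1)] d_sym[OF c(1) c'(2)] d_sym[OF c'(2,1)]
    by (simp add: gromov_def field_simps)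
  then have "gromov a g (a \<otimes> h) > D + \<delta>" using g2 long d_right[OF c(1,2)] by linarith
  \<comment> \<open>By \<open>four_point\<close> at \<open>a\<close>, one of the products of
    \<open>g\<close> with \<open>1\<close> and with \<open>a \<otimes> h\<close> is at most
    \<open>D + \<delta>\<close>, and the second one is too large.\<close>
  then have "gromov a \<one> g \<le> D + \<delta>"
    using four_point[OF one_closed c'(2,1) c(1)] g1 by linarith
  moreover have "gromov a \<one> g = len a - gromov \<one> a g"
    using c c' d_sym[of a \<one>] by (simp add: gromov_def field_simps)
  ultimately show ?thesis using 3 unfolding g_def by linarith
qed

text \<open>Right multiplication by \<open>y\<close> moves \<open>h\<close> by \<open>len y\<close>,
  which enters once in the length and once in the distance to \<open>a\<close>. Thus the right
  factor that makes the inverse reduced for \<open>B\<close> costs only a bounded slack for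
  \<open>A\<close>.\<close>

lemma reduced_perturb:
  assumes "reduced A C h" "A \<subseteq> carrier G" "y \<in> carrier G"
  shows "reduced A (C + 2 * len y) (h \<otimes> y)"
proof -
  have h: "h \<in> carrier G" using assms(1) by (simp add: reduced_def)
  have "len (h \<otimes> y) \<le> d a (h \<otimes> y) + (C + 2 * len y)" if "a \<in> A" for a
  proof -
    have a: "a \<in> carrier G" using that assms(2) by blast
    have "len h \<le> d a h + C" using assms(1) that by (simp add: reduced_def)
    then show ?thesis
      using len_mult_le[OF h assms(3)] d_triangle[of a "h \<otimes> y" h] d_sym[of "h \<otimes> y" h]
        d_right[OF h assms(3)] h a assms(3) by simp
  qed
  then show ?thesis using h assms(3) by (simp add: reduced_def)
qed

text \<open>If no short \<open>u\<close> made \<open>u h\<close> reduced, a point \<open>q\<close> of \<open>[1, h]\<close> far from \<open>1\<close> would be uniformly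
  close to each of the many cosets \<open>inv u A\<close>, while only boundedly many cosets meet a ball.\<close>

lemma ex_reduced_translate:
  assumes A: "subgroup A G" and K: "quasiconvex_const A K" and inf: "\<not> finite_index G A"
  shows "\<exists>n C. \<forall>h\<in>carrier G. \<exists>u\<in>ball n. reduced A C (u \<otimes> h)"
proof -
  have AG: "A \<subseteq> carrier G" using A by (rule subgroup.subset)
  \<comment> \<open>A Gromov product of at most \<open>2 * \<delta>\<close> gives a geodesic point
    within \<open>2 * \<delta> + 2 * \<delta>\<^sub>0 + 1\<close>, and quasiconvexity adds
    \<open>K\<close>. The family \<open>F\<close> has one coset more than there are elements in
    \<open>ball k\<close>.\<close>
  define k where "k = nat \<lceil>K + 2 * \<delta> + 2 * \<delta>\<^sub>0 + 1\<rceil>"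
  obtain F where F: "F \<subseteq> rcosets A" "finite F" "card F = Suc (card (ball k))"
    using inf infinite_arbitrarily_large unfolding finite_index_def by blast
  have "\<forall>X\<in>F. \<exists>u\<in>carrier G. X = A #> u" using F(1) by (auto simp: RCOSETS_def)
  then obtain rep where rep: "\<And>X. X \<in> F \<Longrightarrow> rep X \<in> carrier G \<and> X = A #> rep X" by metis
  define n where "n = Max (insert 0 ((\<lambda>X. len (rep X)) ` F))"
  have n: "len (rep X) \<le> n" if "X \<in> F" for X
    using that F(2) unfolding n_def by (intro Max_ge) auto
  \<comment> \<open>So far from \<open>1\<close> that an element \<open>u\<close> of length at most
    \<open>n\<close> has product above \<open>2 * \<delta>\<close> with \<open>1\<close>, seen from
    a point at distance \<open>t\<close>.\<close>
  define t where "t = n + nat \<lceil>2 * \<delta>\<rceil> + 1"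
  have t: "real t > n + 2 * \<delta>" unfolding t_def by linarith
  have "\<exists>u\<in>ball n. reduced A (t + 2 * n) (u \<otimes> h)" if h: "h \<in> carrier G" for h
  proof (rule ccontr)
    assume neg: "\<not> ?thesis"
    \<comment> \<open>Failure of reducedness, translated back by \<open>inv (rep X)\<close>: a point
      of the coset \<open>inv (rep X) A\<close> is closer to \<open>h\<close> than \<open>1\<close>
      is by more than \<open>t\<close>.\<close>
    have far: "\<exists>v\<in>A. d (inv (rep X) \<otimes> v) h < real (len h) - t" if X: "X \<in> F" for X
    proof -
      have u: "rep X \<in> ball n" "rep X \<in> carrier G" using rep n X by auto
      then obtain v where v: "v \<in> A" "d v (rep X \<otimes> h) + (t + 2 * n) < len (rep X \<otimes> h)"
        using neg h unfolding reduced_def by force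
      have vc: "v \<in> carrier G" using v AG by blast
      have "d (inv (rep X) \<otimes> v) h = d v (rep X \<otimes> h)"
        using d_left[of "rep X" "inv (rep X) \<otimes> v" h] u(2) vc h by (simp del: d_left)
      moreover have "len (rep X \<otimes> h) \<le> n + len h"
        using len_mult_le[OF u(2) h] u(1) by simp
      ultimately show ?thesis using v by (intro bexI[of _ v]) auto
    qed
    have "F \<noteq> {}" using F(3) by auto
    then have "real t \<le> d \<one> h" using far h by force
    obtain p where p: "geodesic G S \<one> h p" using ex_geodesic h by blast
    define q where "q = p ! t"
    note q = geodesic_nth[OF p \<open>real t \<le> d \<one> h\<close>, folded q_def]
    have near: "\<exists>w\<in>ball k. \<exists>a\<in>A. q \<otimes> w = inv (rep X) \<otimes> a" if X: "X \<in> F" for X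
    proof -
      define u where "u = inv (rep X)"
      have u: "u \<in> carrier G" "len u \<le> n" using rep n X by (auto simp: u_def)
      obtain v0 where v0: "v0 \<in> A" "d (u \<otimes> v0) h < real (len h) - t"
        using far[OF X] unfolding u_def by blast
      define v where "v = u \<otimes> v0"
      have v0c: "v0 \<in> carrier G" using v0 AG by blast
      have v: "v \<in> carrier G" "d v h < real (len h) - t"
        using u v0 v0c by (auto simp: v_def)
      have "len h \<le> len v + d v h"
        using d_triangle[of \<one> v h] v h by simp
      then have "gromov \<one> h v > t"
        using v h d_sym[of v h] by (simp add: gromov_def field_simps)
      moreover have "gromov \<one> q h = t" using q(3,4) by (simp add: gromov_def)
      \<comment> \<open>As \<open>h\<close> and \<open>v\<close> have product above \<open>t\<close>
        at \<open>1\<close>, the point \<open>q\<close> of \<open>[1, h]\<close> is also almost on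
        \<open>[1, v]\<close>, which the next product, based at \<open>q\<close>, expresses.\<close>
      ultimately have "t - \<delta> \<le> gromov \<one> q v"
        using four_point[OF q(2) h v(1) one_closed] by simp
      moreover have "gromov q \<one> v = t - gromov \<one> q v"
        using q(2,3) d_sym[of q \<one>] by (simp add: gromov_def field_simps)
      ultimately have "gromov q \<one> v \<le> \<delta>" by linarith
      moreover have "gromov q \<one> u \<ge> real t - n"
        using d_triangle[of \<one> u q] d_sym[of u q] d_sym[of \<one> q] q(2,3) u
        by (simp add: gromov_def field_simps)
      \<comment> \<open>Seen from \<open>q\<close>, the points \<open>1\<close> and \<open>u\<close>
        nearly coincide, so \<open>1\<close> may be replaced by \<open>u\<close>. Then
        \<open>[u, v]\<close> is a translate of a geodesic with both ends in
        \<open>A\<close>.\<close>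
      ultimately have quv: "gromov q u v \<le> 2 * \<delta>"
        using four_point[OF one_closed u(1) v(1) q(2)] t by linarith
      obtain r where r: "geodesic G S \<one> v0 r" using ex_geodesic v0c by blast
      have "gromov (inv u \<otimes> q) \<one> v0 = gromov q u v"
        using gromov_left[of u "inv u \<otimes> q" \<one> v0] u q(2) v0c
        by (simp add: v_def)
      then obtain s where s: "s \<in> set r" "d (inv u \<otimes> q) s \<le> 2 * \<delta> + 2 * \<delta>\<^sub>0 + 1"
        using geodesic_near_gromov[OF r, of "inv u \<otimes> q"] u q(2) v0c quv by fastforce
      obtain a where a: "a \<in> A" "d s a \<le> K"
        using K r s(1) v0(1) subgroup.one_closed[OF A] unfolding quasiconvex_const_def by blast
      have ac: "a \<in> carrier G" using a AG by blast
      have "d (inv u \<otimes> q) a \<le> K + 2 * \<delta> + 2 * \<delta>\<^sub>0 + 1"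
        using d_triangle[of "inv u \<otimes> q" s a] geodesic_mem(1)[OF r s(1)] ac u q(2) s(2) a(2) by simp
      moreover have "d (inv u \<otimes> q) a = d q (u \<otimes> a)"
        using d_left[of u "inv u \<otimes> q" a] u q(2) ac by simp
      moreover have "d q (u \<otimes> a) = len (inv q \<otimes> (u \<otimes> a))" by (simp add: word_dist_def)
      ultimately have "len (inv q \<otimes> (u \<otimes> a)) \<le> k" unfolding k_def by linarith
      then show ?thesis
        using a ac u q(2) by (intro bexI[of _ "inv q \<otimes> (u \<otimes> a)"] bexI[of _ a])
          (auto simp: u_def)
    qed
    then obtain w where w: "\<And>X. X \<in> F \<Longrightarrow> w X \<in> ball k \<and> (\<exists>a\<in>A. q \<otimes> w X = inv (rep X) \<otimes> a)"
      by metis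
    \<comment> \<open>The point \<open>q \<otimes> w X\<close> determines the left coset
      \<open>inv (rep X) A\<close> containing it, and inversion turns that into the right coset
      \<open>X\<close>.\<close>
    have "inj_on w F"
    proof (rule inj_onI)
      fix X Y assume X: "X \<in> F" and Y: "Y \<in> F" and eq: "w X = w Y"
      obtain a b where ab: "a \<in> A" "b \<in> A" "inv (rep X) \<otimes> a = inv (rep Y) \<otimes> b"
        using w[OF X] w[OF Y] eq by metis
      have c: "a \<in> carrier G" "b \<in> carrier G" "rep X \<in> carrier G" "rep Y \<in> carrier G"
        using ab AG rep X Y by auto
      have "inv (inv (rep X) \<otimes> a) = inv (inv (rep Y) \<otimes> b)" using ab(3) by simp
      then have e: "inv a \<otimes> rep X = inv b \<otimes> rep Y" using c by (simp add: inv_mult_group)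
      have "rep X = a \<otimes> (inv a \<otimes> rep X)" using c by simp
      also have "\<dots> = (a \<otimes> inv b) \<otimes> rep Y" using c e by (simp add: m_assoc)
      finally have "rep X \<in> A #> rep Y"
        using ab A subgroup.m_closed[OF A] subgroup.m_inv_closed[OF A]
        unfolding r_coset_def by blast
      then have "A #> rep Y = A #> rep X" using repr_independence A c by blast
      then show "X = Y" using rep X Y by metis
    qed
    then have "card F \<le> card (ball k)"
      using w finite_ball by (intro card_inj_on_le) auto
    then show False using F(3) by simp
  qed
  then show ?thesis by blast
qed

section \<open>Counting reduced elements and double cosets\<close>

lemma double_coset_growth_lower_bound:
  assumes A: "subgroup A G" "quasiconvex_const A K\<^sub>1" "\<not> finite_index G A"
    and B: "subgroup B G" "quasiconvex_const B K\<^sub>2" "\<not> finite_index G B"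
  shows "\<exists>M m. M > 0 \<and> (\<forall>r\<ge>m. growth G S r \<le> M * double_coset_growth G S A B r)"
proof -
  have AG: "A \<subseteq> carrier G" and BG: "B \<subseteq> carrier G"
    using A(1) B(1) subgroup.subset by auto
  obtain n\<^sub>1 C\<^sub>1 where r1: "\<And>h. h \<in> carrier G \<Longrightarrow> \<exists>u\<in>ball n\<^sub>1. reduced A C\<^sub>1 (u \<otimes> h)"
    using ex_reduced_translate[OF A] by blast
  obtain n\<^sub>2 C\<^sub>2 where r2: "\<And>h. h \<in> carrier G \<Longrightarrow> \<exists>u\<in>ball n\<^sub>2. reduced B C\<^sub>2 (u \<otimes> h)"
    using ex_reduced_translate[OF B] by blast
  define m where "m = n\<^sub>1 + n\<^sub>2"
  define C where "C = max (C\<^sub>1 + 2 * n\<^sub>2) C\<^sub>2"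
  define D where "D = C + 2 * \<delta> + max K\<^sub>1 K\<^sub>2 + 1"
  \<comment> \<open>The threshold of \<open>double_coset_rigid\<close>: it serves both as the length
    from which rigidity applies and as the bound on the outer factors.\<close>
  define L where "L = nat \<lceil>2 * D + \<delta>\<rceil>"
  define Z where "Z = {z \<in> carrier G. reduced A C z \<and> reduced B C (inv z)}"
  have ZA: "gromov \<one> a z \<le> D" if "z \<in> Z" "a \<in> A" for z a
    using reduced_gromov_le[OF A(1,2), of C z a] that unfolding Z_def D_def by auto
  have ZB: "gromov \<one> b (inv z) \<le> D" if "z \<in> Z" "b \<in> B" for z b
    using reduced_gromov_le[OF B(1,2), of C "inv z" b] that unfolding Z_def D_def by auto
  have red_mono: "reduced X C' h" if "reduced X C'' h" "C'' \<le> C'" for X C' C'' h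
    using that unfolding reduced_def by force

  have "\<exists>x\<in>ball n\<^sub>1. \<exists>y\<in>ball n\<^sub>2. x \<otimes> h \<otimes> inv y \<in> Z" if h: "h \<in> carrier G" for h
  proof -
    obtain x where x: "x \<in> ball n\<^sub>1" "reduced A C\<^sub>1 (x \<otimes> h)" using r1[OF h] by blast
    have xh: "x \<otimes> h \<in> carrier G" using x h by simp
    obtain y where y: "y \<in> ball n\<^sub>2" "reduced B C\<^sub>2 (y \<otimes> inv (x \<otimes> h))"
      using r2[of "inv (x \<otimes> h)"] xh by blast
    \<comment> \<open>The element is corrected for \<open>A\<close> first and for \<open>B\<close>
      second; only the first property is disturbed afterwards, since the inverse is exactly
      \<open>y \<otimes> inv (x \<otimes> h)\<close>.\<close>
    have "reduced A (C\<^sub>1 + 2 * len (inv y)) (x \<otimes> h \<otimes> inv y)"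
      using reduced_perturb[OF x(2) AG, of "inv y"] y(1) by blast
    then have "reduced A C (x \<otimes> h \<otimes> inv y)"
      using y(1) by (elim red_mono) (auto simp: C_def)
    moreover have "reduced B C (inv (x \<otimes> h \<otimes> inv y))"
      using y xh by (subst inv_mult_group) (auto simp: C_def intro: red_mono)
    ultimately show ?thesis using x(1) y(1) xh unfolding Z_def by blast
  qed
  then have "\<forall>h\<in>carrier G. \<exists>xy. fst xy \<in> ball n\<^sub>1 \<and> snd xy \<in> ball n\<^sub>2 \<and>
      fst xy \<otimes> h \<otimes> inv (snd xy) \<in> Z" unfolding split_paired_Ex fst_conv snd_conv by blast
  from bchoice[OF this] obtain f where f: "\<forall>h\<in>carrier G. fst (f h) \<in> ball n\<^sub>1 \<and>
      snd (f h) \<in> ball n\<^sub>2 \<and> fst (f h) \<otimes> h \<otimes> inv (snd (f h)) \<in> Z" ..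
  define fx fy where "fx h = fst (f h)" and "fy h = snd (f h)" for h
  have fxy: "fx h \<in> ball n\<^sub>1 \<and> fy h \<in> ball n\<^sub>2 \<and> fx h \<otimes> h \<otimes> inv (fy h) \<in> Z"
    if "h \<in> carrier G" for h
    using f that unfolding fx_def fy_def by blast
  have step1: "card (ball r) \<le> card (ball n\<^sub>1) * card (ball n\<^sub>2) * card (Z \<inter> ball (r + m))" for r
  proof -
    \<comment> \<open>Recording both factors makes the correction injective, so each element of
      \<open>Z\<close> is hit boundedly often.\<close>
    define \<phi> where "\<phi> h = ((fx h, fy h), fx h \<otimes> h \<otimes> inv (fy h))" for h
    have "inj_on \<phi> (ball r)"
    proof (rule inj_onI)
      fix g h assume gh: "g \<in> ball r" "h \<in> ball r" "\<phi> g = \<phi> h"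
      have "fx g = fx h" "fy g = fy h" "fx g \<otimes> g \<otimes> inv (fy g) = fx h \<otimes> h \<otimes> inv (fy h)"
        using gh(3) by (auto simp: \<phi>_def)
      then show "g = h" using gh(1,2) fxy[of h] by simp
    qed
    moreover have "\<phi> ` ball r \<subseteq> (ball n\<^sub>1 \<times> ball n\<^sub>2) \<times> (Z \<inter> ball (r + m))"
    proof -
      have "len (fx h \<otimes> h \<otimes> inv (fy h)) \<le> r + m" if "h \<in> ball r" for h
        using that fxy[of h] len_mult_le[of "fx h \<otimes> h" "inv (fy h)"] len_mult_le[of "fx h" h]
        by (simp add: m_def)
      moreover have "Z \<subseteq> carrier G" by (auto simp: Z_def)
      ultimately show ?thesis using fxy unfolding \<phi>_def by fastforce
    qed
    moreover have "finite ((ball n\<^sub>1 \<times> ball n\<^sub>2) \<times> (Z \<inter> ball (r + m)))"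
      using finite_ball by auto
    ultimately have "card (ball r) \<le> card ((ball n\<^sub>1 \<times> ball n\<^sub>2) \<times> (Z \<inter> ball (r + m)))"
      by (rule card_inj_on_le)
    then show ?thesis by (simp add: card_cartesian_product)
  qed

  have rigid: "a \<in> ball L \<and> b \<in> ball L"
    if g: "a \<otimes> h \<otimes> b \<in> Z" and h: "h \<in> Z" "len h > L" and a: "a \<in> A" and b: "b \<in> B" for a h b
  proof -
    have c: "a \<in> carrier G" "h \<in> carrier G" "b \<in> carrier G"
      using a b h AG BG by (auto simp: Z_def)
    have i: "inv a \<in> A" "inv b \<in> B"
      using a b subgroup.m_inv_closed[OF A(1)] subgroup.m_inv_closed[OF B(1)] by blast+
    have long: "len h > 2 * D + \<delta>" using h(2) unfolding L_def by linarith
    have "len a \<le> 2 * D + \<delta>"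
      using double_coset_rigid[OF c ZA[OF h(1) i(1)] ZB[OF h(1) b] ZA[OF g a] long] .
    moreover have e: "inv (a \<otimes> h \<otimes> b) = inv b \<otimes> inv h \<otimes> inv a"
      using c by (simp add: inv_mult_group m_assoc)
    \<comment> \<open>Rigidity for the inverse product, where \<open>A\<close> and \<open>B\<close>
      exchange their roles, bounds the other outer factor.\<close>
    have "len (inv b) \<le> 2 * D + \<delta>"
      using double_coset_rigid[of "inv b" "inv h" "inv a" D] c ZB[OF h(1) b] ZA[OF h(1) i(1)]
        ZB[OF g i(2)] long e by simp
    ultimately show ?thesis using c unfolding L_def by simp linarith
  qed

  define dc where "dc h = double_coset G A h B" for h
  define N where "N = card (ball L) * card (ball L)"
  have fin_dc: "finite (dc ` ball r)" for r using finite_ball by blast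
  have dcg: "double_coset_growth G S A B r = card (dc ` ball r)" for r
    unfolding double_coset_growth_def dc_def by (rule arg_cong[of _ _ card]) auto
  have fibre: "card {g \<in> Z \<inter> ball r. len g > L \<and> dc g = Y} \<le> N" for r Y
  proof (cases "{g \<in> Z \<inter> ball r. len g > L \<and> dc g = Y} = {}")
    case False
    then obtain h where h: "h \<in> Z" "len h > L" "dc h = Y" by blast
    have hc: "h \<in> carrier G" using h by (simp add: Z_def)
    have "{g \<in> Z \<inter> ball r. len g > L \<and> dc g = Y} \<subseteq> (\<lambda>(a, b). a \<otimes> h \<otimes> b) ` (ball L \<times> ball L)"
    proof
      fix g assume "g \<in> {g \<in> Z \<inter> ball r. len g > L \<and> dc g = Y}"
      then have g: "g \<in> Z" "g \<in> carrier G" "dc g = Y" by auto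
      then have "g \<in> dc h" using mem_double_coset[OF A(1) B(1), of g] h(3) by (simp add: dc_def)
      then obtain a b where ab: "a \<in> A" "b \<in> B" "g = a \<otimes> h \<otimes> b"
        unfolding dc_def double_coset_iff[OF AG BG hc] by blast
      have "a \<in> ball L \<and> b \<in> ball L" using rigid[of a h b] g(1) h ab by simp
      then show "g \<in> (\<lambda>(a, b). a \<otimes> h \<otimes> b) ` (ball L \<times> ball L)" using ab(3) by force
    qed
    then have "card {g \<in> Z \<inter> ball r. len g > L \<and> dc g = Y} \<le> card (ball L \<times> ball L)"
      using finite_ball by (intro surj_card_le) auto
    then show ?thesis by (simp add: N_def card_cartesian_product)
  qed (simp only: card.empty)
  have step2: "card (Z \<inter> ball r) \<le> (N + card (ball L)) * card (dc ` ball r)" for r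
  proof -
    \<comment> \<open>Rigidity says nothing about elements of length at most \<open>L\<close>; these
      are simply counted by \<open>ball L\<close>.\<close>
    have "Z \<inter> ball r \<subseteq> ball L \<union> (\<Union>Y\<in>dc ` ball r. {g \<in> Z \<inter> ball r. len g > L \<and> dc g = Y})"
      by auto
    moreover have fin: "finite (\<Union>Y\<in>dc ` ball r. {g \<in> Z \<inter> ball r. len g > L \<and> dc g = Y})"
      by (rule finite_subset[OF _ finite_ball[of r]]) auto
    ultimately have "card (Z \<inter> ball r) \<le>
        card (ball L \<union> (\<Union>Y\<in>dc ` ball r. {g \<in> Z \<inter> ball r. len g > L \<and> dc g = Y}))"
      using finite_ball by (intro card_mono) auto
    also have "\<dots> \<le> card (ball L) +
        card (\<Union>Y\<in>dc ` ball r. {g \<in> Z \<inter> ball r. len g > L \<and> dc g = Y})"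
      by (rule card_Un_le)
    also have "card (\<Union>Y\<in>dc ` ball r. {g \<in> Z \<inter> ball r. len g > L \<and> dc g = Y}) \<le>
        (\<Sum>Y\<in>dc ` ball r. card {g \<in> Z \<inter> ball r. len g > L \<and> dc g = Y})"
      by (rule card_UN_le[OF fin_dc])
    also have "\<dots> \<le> card (dc ` ball r) * N"
      using sum_bounded_above[of "dc ` ball r" _ N] fibre by simp
    finally have 1: "card (Z \<inter> ball r) \<le> card (ball L) + card (dc ` ball r) * N" by simp
    \<comment> \<open>At least one double coset is present, so the additive term
      \<open>card (ball L)\<close> can be absorbed into the factor.\<close>
    have "dc \<one> \<in> dc ` ball r" by (rule imageI) simp
    then have "card (dc ` ball r) \<ge> 1" 
      using fin_dc[of r] by (metis One_nat_def Suc_leI card_gt_0_iff empty_iff)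
    then have "card (ball L) \<le> card (ball L) * card (dc ` ball r)" by simp
    with 1 show ?thesis unfolding add_mult_distrib mult.commute[of _ N] by linarith
  qed

  define M where "M = card (ball m) * (card (ball n\<^sub>1) * card (ball n\<^sub>2) * (N + card (ball L)))"
  have "growth G S r \<le> M * double_coset_growth G S A B r" if "r \<ge> m" for r
  proof -
    \<comment> \<open>Correction lengthens elements by at most \<open>m\<close>, so it is applied to
      \<open>ball s\<close>, whose images stay in \<open>ball r\<close>; the smaller radius costs
      the factor \<open>card (ball m)\<close>.\<close>
    define s where "s = r - m"
    have r: "r = s + m" using that by (simp add: s_def)
    have "card (ball r) \<le> card (ball s) * card (ball m)" unfolding r by (rule card_ball_add_le)
    also have "\<dots> \<le> card (ball n\<^sub>1) * card (ball n\<^sub>2) * card (Z \<inter> ball r) * card (ball m)"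
      using step1[of s] by (simp add: r)
    also have "\<dots> \<le> card (ball n\<^sub>1) * card (ball n\<^sub>2) *
        ((N + card (ball L)) * card (dc ` ball r)) * card (ball m)"
      using step2[of r] by (intro mult_right_mono mult_left_mono) auto
    also have "\<dots> = M * card (dc ` ball r)" by (simp only: M_def ac_simps)
    finally show ?thesis by (simp only: growth_def dcg)
  qed
  moreover have "M > 0" using card_ball_pos by (simp add: M_def)
  ultimately show ?thesis by blast
qed

end

theorem theorem2:
  fixes H :: "('a, 'm) monoid_scheme" and S A B :: "'a set"
  assumes "group H"
    and "finite_generating_set H S"
    and "hyperbolic H S"
    and "\<not> virtually_cyclic H"
    and "subgroup A H" and "quasiconvex H S A" and "\<not> finite_index H A"
    and "subgroup B H" and "quasiconvex H S B" and "\<not> finite_index H B"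
  shows "\<exists>c::real. c > 0 \<and> (\<exists>r0::nat. \<forall>r\<ge>r0.
           real (double_coset_growth H S A B r) \<ge> c * real (growth H S r))"
proof -
  interpret marked_group H S
    using assms(1,2) by (simp add: marked_group_def marked_group_axioms_def)
  obtain \<delta>\<^sub>0 where "hyperbolic_group_axioms H S \<delta>\<^sub>0"
    using assms(3) unfolding hyperbolic_def hyperbolic_group_axioms_def by metis
  then interpret hyperbolic_group H S \<delta>\<^sub>0
    by (intro hyperbolic_group.intro marked_group_axioms)
  obtain K\<^sub>1 K\<^sub>2 where "quasiconvex_const A K\<^sub>1" "quasiconvex_const B K\<^sub>2"
    using assms(6,9) unfolding quasiconvex_def quasiconvex_const_def by blast
  then obtain M m where M: "M > 0"
    "\<And>r. r \<ge> m \<Longrightarrow> growth H S r \<le> M * double_coset_growth H S A B r"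
    using double_coset_growth_lower_bound assms(5,7,8,10) by blast
  have "real (double_coset_growth H S A B r) \<ge> 1 / M * real (growth H S r)" if "r \<ge> m" for r
  proof -
    have "real (growth H S r) \<le> M * double_coset_growth H S A B r"
      using M(2)[OF that] by (metis of_nat_le_iff of_nat_mult)
    then show ?thesis using M(1) by (simp add: field_simps)
  qed
  \<comment> \<open>The constant is the reciprocal of the multiplicity bound \<open>M\<close>, with
    \<open>m\<close> as the initial radius.\<close>
  then show ?thesis using M(1) by (intro exI[of _ "1 / real M"]) auto
qed

end
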